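(* Let $\gamma>1$, $\bar u,\bar v>0$, and suppose $w:=\bar u^{\frac{1-\gamma}{2}}+\frac{1-\gamma}{2}\bar v<0$. Let $\xi_F:=\bar u^{-\frac{\gamma+1}{2}}$ and let $r:\mathbb{R}\setminus\{0\}\to\mathbb{R}$ be the odd function given by $$r(\xi)=\begin{cases}\dfrac{\gamma+1}{\gamma-1}\,\xi^{\frac{\gamma-1}{\gamma+1}}-\dfrac{2}{\gamma-1}w, & 0<\xi\le\xi_F,\\[2mm] \bar u\,\xi+\bar v, & \xi\ge\xi_F,\end{cases}\qquad r(\xi)=-r(-\xi)\ \text{ for }\xi<0,$$ and let $y(x,t)=t\,r(x/t)$. Then there is no contribution of the vacuum state (at $\xi=0$) to the energy, in the sense that for every $0<\bar\xi<\xi_F$, $$E[y,(-\bar\xi,\bar\xi)]=\int_{-\bar\xi}^{\bar\xi}\frac{1}{\gamma(\gamma-1)}|\xi|^{\frac{2(\gamma-1)}{\gamma+1}}+\frac{2}{(\gamma-1)^2}\Big(|\xi|^{\frac{\gamma-1}{\gamma+1}}-w\Big)^2d\xi .$$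
   Context: A mollifier is a function $\phi\in C_c^\infty(\mathbb{R})$ with $\phi\ge0$, $\operatorname{supp}\phi\subset(-1,1)$, $\int\phi=1$; $\phi_n(\xi)=n\phi(n\xi)$. Set $r_n:=\phi_n\star r$ (convolution in $\xi$), $u_n:=r_n'$, $v_n(\xi):=r_n(\xi)-\xi r_n'(\xi)$. For $\bar\xi>0$ the energy of $y$ inside the wave fan from $-\bar\xi$ to $\bar\xi$ is $$E[y,(-\bar\xi,\bar\xi)]:=\lim_{n\to\infty}\int_{-\bar\xi}^{\bar\xi}W(u_n)+\tfrac12(v_n)^2\,d\xi,\qquad W(u)=\frac{1}{\gamma(\gamma-1)}u^{1-\gamma}.$$ *)

theory Defs
  imports "HOL-Analysis.Analysis"
begin

definition smooth :: "(real \<Rightarrow> real) \<Rightarrow> bool" where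
  "smooth f \<longleftrightarrow> (\<forall>k x. (deriv ^^ k) f differentiable (at x))"

definition topological_support :: "(real \<Rightarrow> real) \<Rightarrow> real set" where
  "topological_support f = closure {x. f x \<noteq> 0}"

definition mollifier :: "(real \<Rightarrow> real) \<Rightarrow> bool" where
  "mollifier \<phi> \<longleftrightarrow> smooth \<phi> \<and> compact (topological_support \<phi>) \<and> (\<forall>x. 0 \<le> \<phi> x) \<and>
     topological_support \<phi> \<subseteq> {-1<..<1} \<and> (LBINT x. \<phi> x) = 1"

definition rescale :: "(real \<Rightarrow> real) \<Rightarrow> nat \<Rightarrow> real \<Rightarrow> real" where
  "rescale \<phi> n \<xi> = real n * \<phi> (real n * \<xi>)"

definition convolve :: "(real \<Rightarrow> real) \<Rightarrow> (real \<Rightarrow> real) \<Rightarrow> real \<Rightarrow> real" where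
  "convolve f g \<xi> = (LBINT s. f (\<xi> - s) * g s)"

definition r_moll :: "(real \<Rightarrow> real) \<Rightarrow> (real \<Rightarrow> real) \<Rightarrow> nat \<Rightarrow> real \<Rightarrow> real" where
  "r_moll \<phi> r n = convolve (rescale \<phi> n) r"

definition u_moll :: "(real \<Rightarrow> real) \<Rightarrow> (real \<Rightarrow> real) \<Rightarrow> nat \<Rightarrow> real \<Rightarrow> real" where
  "u_moll \<phi> r n \<xi> = deriv (r_moll \<phi> r n) \<xi>"

definition v_moll :: "(real \<Rightarrow> real) \<Rightarrow> (real \<Rightarrow> real) \<Rightarrow> nat \<Rightarrow> real \<Rightarrow> real" where
  "v_moll \<phi> r n \<xi> = r_moll \<phi> r n \<xi> - \<xi> * deriv (r_moll \<phi> r n) \<xi>"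

(* Meaningful for u > 0 only; positivity of the argument is required wherever W is used below. *)
definition W :: "real \<Rightarrow> real \<Rightarrow> real" where
  "W \<gamma> u = 1 / (\<gamma> * (\<gamma> - 1)) * u powr (1 - \<gamma>)"

definition energy_density :: "real \<Rightarrow> (real \<Rightarrow> real) \<Rightarrow> (real \<Rightarrow> real) \<Rightarrow> nat \<Rightarrow> real \<Rightarrow> real" where
  "energy_density \<gamma> \<phi> r n \<xi> = W \<gamma> (u_moll \<phi> r n \<xi>) + 1/2 * (v_moll \<phi> r n \<xi>)\<^sup>2"

(* A self-similar motion y(x,t) = t r(x/t) has the profile r(xi) = y(xi,1). *)
definition profile :: "(real \<Rightarrow> real \<Rightarrow> real) \<Rightarrow> real \<Rightarrow> real" where
  "profile y \<xi> = y \<xi> 1"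

(* has_fan_energy gamma phi y a E states E[y,(-a,a)] = E. It is a relation, in the style of
   has_integral, since the equation asserts that the limit exists: the first two conjuncts say
   that the expressions under the limit are genuine (for all large n), the third is the limit. *)
definition has_fan_energy ::
  "real \<Rightarrow> (real \<Rightarrow> real) \<Rightarrow> (real \<Rightarrow> real \<Rightarrow> real) \<Rightarrow> real \<Rightarrow> real \<Rightarrow> bool" where
  "has_fan_energy \<gamma> \<phi> y a E \<longleftrightarrow>
     (\<forall>\<^sub>F n in sequentially. \<forall>\<xi>\<in>{-a..a}.
        r_moll \<phi> (profile y) n differentiable (at \<xi>) \<and> 0 < u_moll \<phi> (profile y) n \<xi>) \<and>
     (\<forall>\<^sub>F n in sequentially.
        set_integrable lborel {-a..a} (energy_density \<gamma> \<phi> (profile y) n)) \<and>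
     (\<lambda>n. LBINT \<xi>:{-a..a}. energy_density \<gamma> \<phi> (profile y) n \<xi>) \<longlonglongrightarrow> E"

lemma has_fan_energy_unique:
  "has_fan_energy \<gamma> \<phi> y a E \<Longrightarrow> has_fan_energy \<gamma> \<phi> y a E' \<Longrightarrow> E = E'"
  unfolding has_fan_energy_def using LIMSEQ_unique by blast

(* The two branches of the wave fan profile agree where they overlap. *)
lemma branches_agree:
  fixes \<gamma> ubar vbar w xiF :: real
  assumes "\<gamma> > 1" "ubar > 0"
    and w: "w = ubar powr ((1 - \<gamma>) / 2) + (1 - \<gamma>) / 2 * vbar"
    and xiF: "xiF = ubar powr (- (\<gamma> + 1) / 2)"
  shows "(\<gamma> + 1) / (\<gamma> - 1) * xiF powr ((\<gamma> - 1) / (\<gamma> + 1)) - 2 / (\<gamma> - 1) * w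
       = ubar * xiF + vbar"
proof -
  define p where "p = ubar powr ((1 - \<gamma>) / 2)"
  have a: "- (\<gamma> + 1) / 2 * ((\<gamma> - 1) / (\<gamma> + 1)) = (1 - \<gamma>) / 2"
    using assms(1) by (simp add: field_simps)
  have 1: "xiF powr ((\<gamma> - 1) / (\<gamma> + 1)) = p"
    unfolding xiF powr_powr p_def a ..
  have "ubar * xiF = ubar powr 1 * ubar powr (- (\<gamma> + 1) / 2)"
    using assms(2) xiF by simp
  also have "\<dots> = ubar powr (1 + (- (\<gamma> + 1) / 2))" by (rule powr_add[symmetric])
  also have "1 + (- (\<gamma> + 1) / 2) = (1 - \<gamma>) / 2" by (simp add: field_simps)
  finally have 2: "ubar * xiF = p" by (simp add: p_def)
  have w': "w = p + (1 - \<gamma>) / 2 * vbar" using w p_def by simp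
  show ?thesis unfolding 1 2 w' using assms(1) by (simp add: divide_simps) (simp add: algebra_simps)
qed

end

theory Submission
  imports Defs
begin

text \<open>
  Near the fan the profile is \<open>F s = sgn s * (\<bar>s\<bar> powr \<beta> / \<beta> + c)\<close> with
  \<open>\<beta> = (\<gamma> - 1) / (\<gamma> + 1)\<close> and \<open>c = - 2 w / (\<gamma> - 1)\<close>, which jumps upwards at the vacuum.
  Convolution with a probability density preserves bounds on difference quotients. Hence
  \<open>u\<^sub>n\<close> is bounded below by a positive constant, also across the jump, so \<open>W(u\<^sub>n)\<close> stays bounded,
  and away from the vacuum \<open>u\<^sub>n \<xi>\<close> is squeezed between values of \<open>F'\<close> near \<open>\<xi>\<close>.
  The concentration \<open>u\<^sub>n = O(n)\<close> lives on \<open>\<bar>\<xi>\<bar> \<le> 4 / n\<close>, where the factor \<open>\<xi>\<close> in \<open>v\<^sub>n\<close>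
  compensates it. The energy density is therefore uniformly bounded, and dominated convergence applies.
\<close>

section \<open>Convolution of a locally bounded function with a continuous compactly supported
  kernel\<close>

text \<open>Sign and mass of the kernel are left out so that the derivative of a mollifier qualifies
  as well; they are added where the convolution acts as an average.\<close>

definition bump :: "real \<Rightarrow> (real \<Rightarrow> real) \<Rightarrow> bool" where
  "bump d f \<longleftrightarrow> continuous_on UNIV f \<and> (\<forall>x. d \<le> \<bar>x\<bar> \<longrightarrow> f x = 0)"

text \<open>Continuity is not asked for, since the profile jumps at the vacuum.\<close>

definition locally_bounded :: "(real \<Rightarrow> real) \<Rightarrow> bool" where
  "locally_bounded g \<longleftrightarrow>
     g \<in> borel_measurable borel \<and> (\<forall>\<rho>. \<exists>B\<ge>0. \<forall>s. \<bar>s\<bar> \<le> \<rho> \<longrightarrow> \<bar>g s\<bar> \<le> B)"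

lemma bump_bounded:
  assumes "bump d f"
  obtains K where "0 \<le> K" "\<And>x. \<bar>f x\<bar> \<le> K"
proof -
  have "continuous_on {-d..d} f"
    using assms unfolding bump_def by (blast intro: continuous_on_subset)
  then have "bounded (f ` {-d..d})"
    by (intro compact_imp_bounded compact_continuous_image) auto
  then obtain K where K: "K > 0" "\<And>y. y \<in> f ` {-d..d} \<Longrightarrow> norm y \<le> K"
    using bounded_pos by metis
  have "\<bar>f x\<bar> \<le> K" for x
  proof (cases "\<bar>x\<bar> \<le> d")
    case True
    then have "x \<in> {-d..d}" by auto
    with K(2)[of "f x"] show ?thesis by auto
  next
    case False
    then show ?thesis using assms K(1) by (auto simp: bump_def)
  qed
  with K(1) show ?thesis using that[of K] by auto
qed

lemma bump_measurable: "bump d f \<Longrightarrow> f \<in> borel_measurable borel"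
  unfolding bump_def by (blast intro: borel_measurable_continuous_onI)

lemma integrable_indicator_Icc: "integrable lborel (\<lambda>s. C * indicator {p..q::real} s :: real)"
  by (intro integrable_mult_right integrable_real_indicator) (auto simp: emeasure_lborel_Icc_eq)

lemma convolve_integrable:
  assumes f: "bump d f" and g: "locally_bounded g"
  shows "integrable lborel (\<lambda>s. f (x - s) * g s)"
proof -
  obtain K where K: "0 \<le> K" "\<And>x. \<bar>f x\<bar> \<le> K" using bump_bounded[OF f] by blast
  obtain B where B: "0 \<le> B" "\<And>s. \<bar>s\<bar> \<le> \<bar>x\<bar> + \<bar>d\<bar> \<Longrightarrow> \<bar>g s\<bar> \<le> B"
    using g unfolding locally_bounded_def by metis
  have [measurable]: "f \<in> borel_measurable borel" "g \<in> borel_measurable borel"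
    using bump_measurable[OF f] g by (auto simp: locally_bounded_def)
  show ?thesis
  proof (rule Bochner_Integration.integrable_bound)
    show "integrable lborel (\<lambda>s. K * B * indicator {x-d..x+d} s :: real)"
      by (rule integrable_indicator_Icc)
    have "norm (f (x - s) * g s) \<le> norm (K * B * indicator {x-d..x+d} s)" for s
    proof (cases "\<bar>x - s\<bar> < d")
      case True
      then have "\<bar>f (x - s)\<bar> * \<bar>g s\<bar> \<le> K * B" by (intro mult_mono K B) auto
      with True K(1) B(1) show ?thesis by (auto simp: abs_mult indicator_def)
    next
      case False
      then show ?thesis using f by (auto simp: bump_def)
    qed
    then show "AE s in lborel. norm (f (x - s) * g s) \<le> norm (K * B * indicator {x-d..x+d} s)"
      by auto
  qed measurable
qed

text \<open>A sup bound times the window length \<open>2 * d\<close>. It serves for kernels without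
  a sign, such as the derivative of a mollifier, where comparison by monotonicity fails.\<close>

lemma convolve_abs_le:
  assumes f: "bump d f" and g: "locally_bounded g" and "0 \<le> d"
    and K: "\<And>x. \<bar>f x\<bar> \<le> K" and B: "\<And>s. \<bar>x - s\<bar> < d \<Longrightarrow> \<bar>g s\<bar> \<le> B" and "0 \<le> B"
  shows "\<bar>convolve f g x\<bar> \<le> K * B * (2 * d)"
proof -
  have "0 \<le> K" using K[of 0] by linarith
  have "\<bar>convolve f g x\<bar> \<le> (LBINT s. \<bar>f (x - s) * g s\<bar>)"
    unfolding convolve_def using integral_norm_bound[of lborel "\<lambda>s. f (x - s) * g s"] by simp
  also have "\<dots> \<le> (LBINT s. K * B * indicator {x-d..x+d} s)"
  proof (rule integral_mono)
    show "integrable lborel (\<lambda>s. \<bar>f (x - s) * g s\<bar>)"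
      using convolve_integrable[OF f g] by (rule integrable_abs)
    show "integrable lborel (\<lambda>s. K * B * indicator {x-d..x+d} s :: real)"
      by (rule integrable_indicator_Icc)
    fix s :: real
    show "\<bar>f (x - s) * g s\<bar> \<le> K * B * indicator {x-d..x+d} s"
    proof (cases "\<bar>x - s\<bar> < d")
      case True
      then have "\<bar>f (x - s)\<bar> * \<bar>g s\<bar> \<le> K * B"
        using \<open>0 \<le> K\<close> by (intro mult_mono K B) auto
      with True show ?thesis by (auto simp: abs_mult indicator_def)
    next
      case False
      then show ?thesis using f \<open>0 \<le> K\<close> \<open>0 \<le> B\<close> by (auto simp: bump_def)
    qed
  qed
  also have "\<dots> = K * B * (2 * d)" using \<open>0 \<le> d\<close> by simp
  finally show ?thesis .
qed

text \<open>Differentiation under the integral: the difference quotient falls on the smooth kernel,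
  so \<open>g\<close> may jump. Passing to sequences makes dominated convergence applicable; the
  majorant comes from the Lipschitz constant of \<open>f\<close>.\<close>

lemma convolve_has_derivative:
  assumes f: "bump d f" and f': "bump d f'" and g: "locally_bounded g"
    and der: "\<And>x. (f has_real_derivative f' x) (at x)"
  shows "(convolve f g has_real_derivative convolve f' g x) (at x)"
  unfolding DERIV_def tendsto_at_iff_sequentially
proof (intro allI impI)
  fix X :: "nat \<Rightarrow> real"
  assume X0: "\<forall>i. X i \<in> UNIV - {0}" and X: "X \<longlonglongrightarrow> 0"
  \<comment> \<open>\<open>M\<close> bounds all increments at once, so every shifted window lies in
    one fixed interval, which carries the majorant.\<close>
  obtain M where M: "\<And>i. \<bar>X i\<bar> \<le> M"
    using X convergent_imp_Bseq[of X] unfolding Bseq_def convergent_def by auto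
  obtain K where K: "0 \<le> K" "\<And>x. \<bar>f' x\<bar> \<le> K" using bump_bounded[OF f'] by blast
  obtain B where B: "0 \<le> B" "\<And>s. \<bar>s\<bar> \<le> \<bar>x\<bar> + \<bar>d\<bar> + M \<Longrightarrow> \<bar>g s\<bar> \<le> B"
    using g unfolding locally_bounded_def by metis
  have [measurable]: "f \<in> borel_measurable borel" "f' \<in> borel_measurable borel"
    "g \<in> borel_measurable borel"
    using bump_measurable[OF f] bump_measurable[OF f'] g by (auto simp: locally_bounded_def)
  have lip: "\<bar>f p - f q\<bar> \<le> K * \<bar>p - q\<bar>" for p q
    using field_differentiable_bound[of UNIV f f' K p q] der K by auto
  define q where "q i s = (f (x + X i - s) - f (x - s)) / X i * g s" for i s
  have eq: "(convolve f g (x + X i) - convolve f g x) / X i = (LBINT s. q i s)" for i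
  proof -
    have "convolve f g (x + X i) - convolve f g x
        = (LBINT s. f (x + X i - s) * g s - f (x - s) * g s)"
      unfolding convolve_def
      by (rule Bochner_Integration.integral_diff[symmetric]; rule convolve_integrable[OF f g])
    also have "\<dots> = (LBINT s. X i * q i s)"
      using X0 by (intro Bochner_Integration.integral_cong) (auto simp: q_def field_simps)
    finally show ?thesis using X0 by simp
  qed
  have "(\<lambda>i. LBINT s. q i s) \<longlonglongrightarrow> convolve f' g x"
    unfolding convolve_def
  proof (rule integral_dominated_convergence)
    show "integrable lborel (\<lambda>s. K * B * indicator {x-d-M..x+d+M} s :: real)"
      by (rule integrable_indicator_Icc)
    show "AE s in lborel. (\<lambda>i. q i s) \<longlonglongrightarrow> f' (x - s) * g s"
    proof (rule AE_I2)
      fix s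
      have "(\<lambda>i. (f ((x - s) + X i) - f (x - s)) / X i) \<longlonglongrightarrow> f' (x - s)"
        using der[of "x - s"] X X0 unfolding DERIV_def tendsto_at_iff_sequentially
        by (auto simp: o_def)
      then show "(\<lambda>i. q i s) \<longlonglongrightarrow> f' (x - s) * g s"
        unfolding q_def by (intro tendsto_intros) (simp add: algebra_simps)
    qed
    fix i
    have "norm (q i s) \<le> K * B * indicator {x-d-M..x+d+M} s" for s
    proof (cases "s \<in> {x-d-M..x+d+M}")
      case True
      have 1: "\<bar>f (x + X i - s) - f (x - s)\<bar> / \<bar>X i\<bar> \<le> K"
        using lip[of "x + X i - s" "x - s"] X0 by (auto simp: divide_le_eq)
      have 2: "\<bar>g s\<bar> \<le> B" using True by (intro B) auto
      have "norm (q i s) = \<bar>f (x + X i - s) - f (x - s)\<bar> / \<bar>X i\<bar> * \<bar>g s\<bar>"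
        by (simp add: q_def abs_mult)
      also have "\<dots> \<le> K * B" using 1 2 K(1) by (intro mult_mono) auto
      finally show ?thesis using True by simp
    next
      case False
      \<comment> \<open>Here both shifted arguments leave the support of the kernel, so the quotient
        vanishes.\<close>
      then have "d \<le> \<bar>x + X i - s\<bar>" "d \<le> \<bar>x - s\<bar>" using M[of i] by auto
      then show ?thesis using f False by (simp add: q_def bump_def)
    qed
    then show "AE s in lborel. norm (q i s) \<le> K * B * indicator {x-d-M..x+d+M} s" by auto
    show "q i \<in> borel_measurable lborel" unfolding q_def by measurable
  qed measurable
  then show "((\<lambda>h. (convolve f g (x + h) - convolve f g x) / h) \<circ> X) \<longlonglongrightarrow> convolve f' g x"
    by (simp add: o_def eq)
qed

section \<open>Slope bounds under convolution with a probability density\<close>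

text \<open>The substitution \<open>s + h\<close> for \<open>s\<close> moves the increment from the
  kernel to \<open>g\<close>, so that difference quotients of the convolution become averages of
  those of \<open>g\<close>.\<close>

lemma convolve_translate: "convolve f g (x + h) = convolve f (\<lambda>s. g (s + h)) x"
  unfolding convolve_def
  using lborel_integral_real_affine[of 1 "\<lambda>s. f (x + h - s) * g s" h] by (simp add: algebra_simps)

lemma locally_bounded_translate:
  assumes "locally_bounded g"
  shows "locally_bounded (\<lambda>s. g (s + h))"
  unfolding locally_bounded_def
proof (intro conjI allI)
  have [measurable]: "g \<in> borel_measurable borel" using assms by (simp add: locally_bounded_def)
  show "(\<lambda>s. g (s + h)) \<in> borel_measurable borel" by measurable
  fix \<rho>
  obtain B where "0 \<le> B" "\<And>s. \<bar>s\<bar> \<le> \<rho> + \<bar>h\<bar> \<Longrightarrow> \<bar>g s\<bar> \<le> B"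
    using assms unfolding locally_bounded_def by metis
  then show "\<exists>B\<ge>0. \<forall>s. \<bar>s\<bar> \<le> \<rho> \<longrightarrow> \<bar>g (s + h)\<bar> \<le> B"
    by (intro exI[of _ B]) auto
qed

lemma locally_bounded_const: "locally_bounded (\<lambda>_. c)"
  unfolding locally_bounded_def by (auto intro: exI[of _ "\<bar>c\<bar>"])

lemma convolve_mono:
  assumes f: "bump d f" "\<And>x. 0 \<le> f x" and g: "locally_bounded g" "locally_bounded k"
    and "\<And>s. \<bar>x - s\<bar> < d \<Longrightarrow> g s \<le> k s"
  shows "convolve f g x \<le> convolve f k x"
  unfolding convolve_def
proof (rule integral_mono[OF convolve_integrable[OF f(1) g(1)] convolve_integrable[OF f(1) g(2)]])
  fix s
  show "f (x - s) * g s \<le> f (x - s) * k s"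
    using assms by (cases "\<bar>x - s\<bar> < d") (auto intro: mult_left_mono simp: bump_def)
qed

lemma convolve_const:
  assumes "(LBINT s. f s) = 1"
  shows "convolve f (\<lambda>_. c) x = c"
  unfolding convolve_def
  \<comment> \<open>The affine change of variables is the reflection taking \<open>s\<close> to
    \<open>x - s\<close>.\<close>
  using lborel_integral_real_affine[of "-1" f x] assms by simp

text \<open>\<open>D\<close> is a limit of weighted averages of
  \<open>(g (s + h) - g s) / h\<close>, so it inherits any bound on these quotients;
  \<open>g\<close> itself need be neither differentiable nor continuous. Only \<open>h > 0\<close>
  is used, hence the slack \<open>\<delta>\<close> sits on the right end of the window
  alone.\<close>

lemma
  assumes f: "bump d f" "\<And>x. 0 \<le> f x" "(LBINT s. f s) = 1" and g: "locally_bounded g"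
    and der: "(convolve f g has_real_derivative D) (at x)" and "0 < \<delta>"
  shows convolve_derivative_ge:
      "(\<And>s t. x - d < s \<Longrightarrow> s < t \<Longrightarrow> t < x + d + \<delta> \<Longrightarrow> m * (t - s) \<le> g t - g s) \<Longrightarrow> m \<le> D"
    and convolve_derivative_le:
      "(\<And>s t. x - d < s \<Longrightarrow> s < t \<Longrightarrow> t < x + d + \<delta> \<Longrightarrow> g t - g s \<le> M * (t - s)) \<Longrightarrow> D \<le> M"
proof -
  let ?Q = "\<lambda>h. (convolve f g (x + h) - convolve f g x) / h"
  \<comment> \<open>The two-sided derivative exists by assumption, so it can be read off from the
    right.\<close>
  have lim: "(?Q \<longlongrightarrow> D) (at_right 0)"
    using der unfolding DERIV_def by (rule filterlim_mono) (auto simp: at_le)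
  have ev: "\<forall>\<^sub>F h in at_right 0. 0 < h \<and> h < \<delta>"
    using \<open>0 < \<delta>\<close> by (auto simp: eventually_at_right)
  have gc: "locally_bounded (\<lambda>s. g s + c)" for c
    unfolding locally_bounded_def
  proof (intro conjI allI)
    have [measurable]: "g \<in> borel_measurable borel" using g by (simp add: locally_bounded_def)
    show "(\<lambda>s. g s + c) \<in> borel_measurable borel" by measurable
    fix \<rho>
    obtain B where B: "0 \<le> B" "\<And>s. \<bar>s\<bar> \<le> \<rho> \<Longrightarrow> \<bar>g s\<bar> \<le> B"
      using g unfolding locally_bounded_def by metis
    then show "\<exists>B\<ge>0. \<forall>s. \<bar>s\<bar> \<le> \<rho> \<longrightarrow> \<bar>g s + c\<bar> \<le> B"
      by (intro exI[of _ "B + \<bar>c\<bar>"]) (auto intro: order_trans[OF abs_triangle_ineq] add_mono)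
  qed
  have shift: "convolve f (\<lambda>s. g s + c) x = convolve f g x + c" for c
  proof -
    have "convolve f (\<lambda>s. g s + c) x = convolve f g x + convolve f (\<lambda>_. c) x"
      unfolding convolve_def distrib_left
      by (intro Bochner_Integration.integral_add convolve_integrable[OF f(1)] g
          locally_bounded_const)
    then show ?thesis by (simp add: convolve_const[OF f(3)])
  qed
  have window: "x - d < s" "s < s + h" "s + h < x + d + \<delta>"
    if "0 < h" "h < \<delta>" "\<bar>x - s\<bar> < d" for s h
    using that by (auto simp: abs_less_iff)
  show "m \<le> D"
    if slope: "\<And>s t. x - d < s \<Longrightarrow> s < t \<Longrightarrow> t < x + d + \<delta> \<Longrightarrow> m * (t - s) \<le> g t - g s"
  proof (rule tendsto_lowerbound[OF lim eventually_mono[OF ev]])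
    fix h assume h: "0 < h \<and> h < \<delta>"
    \<comment> \<open>The slope bound becomes a pointwise comparison on the window; unit mass then
      carries the constant \<open>m * h\<close> through the convolution unchanged.\<close>
    have "g s + m * h \<le> g (s + h)" if "\<bar>x - s\<bar> < d" for s
      using slope[OF window[of h s]] h that by simp
    then have "convolve f (\<lambda>s. g s + m * h) x \<le> convolve f (\<lambda>s. g (s + h)) x"
      by (rule convolve_mono[OF f(1,2) gc locally_bounded_translate[OF g]])
    then show "m \<le> ?Q h"
      using h by (simp only: shift convolve_translate[of f g x h]) (simp add: field_simps)
  qed simp
  show "D \<le> M"
    if slope: "\<And>s t. x - d < s \<Longrightarrow> s < t \<Longrightarrow> t < x + d + \<delta> \<Longrightarrow> g t - g s \<le> M * (t - s)"
  proof (rule tendsto_upperbound[OF lim eventually_mono[OF ev]])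
    fix h assume h: "0 < h \<and> h < \<delta>"
    have "g (s + h) \<le> g s + M * h" if "\<bar>x - s\<bar> < d" for s
      using slope[OF window[of h s]] h that by simp
    then have "convolve f (\<lambda>s. g (s + h)) x \<le> convolve f (\<lambda>s. g s + M * h) x"
      by (rule convolve_mono[OF f(1,2) locally_bounded_translate[OF g] gc])
    then show "?Q h \<le> M"
      using h by (simp only: shift convolve_translate[of f g x h]) (simp add: field_simps)
  qed simp
qed

section \<open>Mollifiers, their derivatives and their rescalings as kernels\<close>

lemma smooth_deriv: "smooth f \<Longrightarrow> smooth (deriv f)"
  unfolding smooth_def by (metis funpow_Suc_right o_apply)

lemma smooth_DERIV: "smooth f \<Longrightarrow> (f has_real_derivative deriv f x) (at x)"
  unfolding smooth_def by (metis DERIV_deriv_iff_real_differentiable funpow_0)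

text \<open>Off the closed support, \<open>f\<close> vanishes on a whole neighbourhood, so its
  derivative is zero there.\<close>

lemma support_deriv: "topological_support (deriv f) \<subseteq> topological_support f"
proof -
  have "deriv f x = 0" if x: "x \<notin> topological_support f" for x
  proof -
    have "open (- topological_support f)" by (auto simp: topological_support_def)
    then have "\<forall>\<^sub>F z in nhds x. z \<in> - topological_support f"
      using x by (intro eventually_nhds_in_open) auto
    then have "\<forall>\<^sub>F z in nhds x. f z = 0"
      by (rule eventually_mono) (use closure_subset[of "{x. f x \<noteq> 0}"] in \<open>auto simp: topological_support_def\<close>)
    then have "deriv f x = deriv (\<lambda>_. 0) x" by (intro deriv_cong_ev) auto
    then show ?thesis by simp
  qed
  then have "{x. deriv f x \<noteq> 0} \<subseteq> topological_support f" by auto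
  then show ?thesis
    unfolding topological_support_def[of "deriv f"]
    by (intro closure_minimal) (auto simp: topological_support_def)
qed

lemma bump_smooth:
  assumes "smooth f" "topological_support f \<subseteq> {-1<..<1}"
  shows "bump 1 f"
  unfolding bump_def
proof (intro conjI allI impI)
  show "continuous_on UNIV f"
    by (meson DERIV_isCont assms(1) continuous_at_imp_continuous_on smooth_DERIV)
  fix x :: real assume "1 \<le> \<bar>x\<bar>"
  then have "x \<notin> topological_support f" using assms(2) by (auto simp: subset_iff abs_if split: if_splits)
  then show "f x = 0"
    using closure_subset[of "{x. f x \<noteq> 0}"] by (auto simp: topological_support_def)
qed

lemma bump_rescale:
  assumes "bump 1 f" "0 < n"
  shows "bump (1 / real n) (rescale f n)"
  unfolding bump_def rescale_def
proof (intro conjI allI impI)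
  have "continuous_on UNIV f" using assms(1) by (simp add: bump_def)
  then show "continuous_on UNIV (\<lambda>\<xi>. real n * f (real n * \<xi>))"
    by (rule continuous_on_mult[OF continuous_on_const continuous_on_compose2])
      (auto intro: continuous_intros)
  fix x assume "1 / real n \<le> \<bar>x\<bar>"
  then have "1 \<le> \<bar>real n * x\<bar>" using assms(2) by (simp add: field_simps abs_mult)
  then show "real n * f (real n * x) = 0" using assms(1) by (simp add: bump_def)
qed

lemma bump_cmult: "bump d f \<Longrightarrow> bump d (\<lambda>x. c * f x)"
  unfolding bump_def by (auto intro: continuous_intros)

lemma integral_rescale:
  assumes "0 < n"
  shows "(LBINT x. rescale f n x) = (LBINT x. f x)"
  using lborel_integral_real_affine[of "real n" f 0] assms by (simp add: rescale_def)

lemma convolve_cmult: "convolve (\<lambda>x. c * f x) g x = c * convolve f g x"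
  unfolding convolve_def by (simp add: mult.assoc)

text \<open>By the chain rule the rescaled kernel has derivative \<open>n\<close> times the rescaled
  \<open>deriv f\<close>. Writing the result again as an \<open>r_moll\<close> lets the lemma be
  applied a second time.\<close>

lemma r_moll_has_derivative:
  assumes "smooth f" "topological_support f \<subseteq> {-1<..<1}" "0 < n" "locally_bounded g"
  shows "(r_moll f g n has_real_derivative real n * r_moll (deriv f) g n x) (at x)"
proof -
  have b: "bump (1 / real n) (rescale f n)" "bump (1 / real n) (rescale (deriv f) n)"
    using assms support_deriv[of f] by (auto intro!: bump_rescale bump_smooth smooth_deriv)
  have "(rescale f n has_real_derivative real n * rescale (deriv f) n x) (at x)" for x
    unfolding rescale_def
    by (auto intro!: derivative_eq_intros DERIV_chain2[where f=f] smooth_DERIV assms)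
  from convolve_has_derivative[OF b(1) bump_cmult[OF b(2)] assms(4) this]
  show ?thesis by (simp add: r_moll_def convolve_cmult)
qed

text \<open>The value of the profile at 0 is unspecified, and one point is null. The integrand with
  \<open>h\<close> is rewritten as a modification of the one with \<open>g\<close> at that point,
  which also makes it measurable.\<close>

lemma r_moll_cong:
  assumes f: "bump 1 f" and "0 < n" and [measurable]: "g \<in> borel_measurable borel"
    and eq: "\<And>s. s \<noteq> 0 \<Longrightarrow> \<bar>\<xi> - s\<bar> < 1 / real n \<Longrightarrow> h s = g s"
  shows "r_moll f h n \<xi> = r_moll f g n \<xi>"
proof -
  have [measurable]: "rescale f n \<in> borel_measurable borel"
    by (rule bump_measurable[OF bump_rescale[OF f \<open>0 < n\<close>]])
  let ?k = "\<lambda>s. rescale f n (\<xi> - s) * g s"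
  have "rescale f n (\<xi> - s) * h s = ?k s" if "s \<noteq> 0" for s
    using bump_rescale[OF f \<open>0 < n\<close>] eq[OF that]
    by (cases "\<bar>\<xi> - s\<bar> < 1 / real n") (auto simp: bump_def)
  then have *: "(\<lambda>s. rescale f n (\<xi> - s) * h s)
      = (\<lambda>s. if s = 0 then rescale f n \<xi> * h 0 else ?k s)" by auto
  have "(LBINT s. (if s = 0 then rescale f n \<xi> * h 0 else ?k s)) = (LBINT s. ?k s)"
  proof (rule integral_cong_AE)
    show "AE s in lborel. (if s = 0 then rescale f n \<xi> * h 0 else ?k s) = ?k s"
      using AE_lborel_singleton[of "0::real"] by eventually_elim auto
  qed measurable
  then show ?thesis by (simp add: r_moll_def convolve_def *)
qed

section \<open>The fan profile and its slopes\<close>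

text \<open>The inner branch is continued to the whole line, so that no cut at the fan edge
  interferes with the estimates. Dividing by \<open>\<beta>\<close> makes the slope off 0 exactly
  \<open>\<bar>s\<bar> powr (\<beta> - 1)\<close>; the jump at 0 has height
  \<open>2 * c\<close>.\<close>

definition fan :: "real \<Rightarrow> real \<Rightarrow> real \<Rightarrow> real" where
  "fan \<beta> c s = sgn s * (\<bar>s\<bar> powr \<beta> / \<beta> + c)"

lemma fan_minus: "fan \<beta> c (- s) = - fan \<beta> c s"
  by (simp add: fan_def sgn_minus)

lemma abs_fan_le:
  assumes "0 < \<beta>" "0 \<le> c" "\<bar>s\<bar> \<le> \<rho>"
  shows "\<bar>fan \<beta> c s\<bar> \<le> \<rho> powr \<beta> / \<beta> + c"
proof -
  have "\<bar>s\<bar> powr \<beta> / \<beta> \<le> \<rho> powr \<beta> / \<beta>"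
    using assms by (intro divide_right_mono powr_mono2) auto
  then show ?thesis using assms by (auto simp: fan_def abs_mult abs_sgn_eq)
qed

lemma locally_bounded_fan:
  assumes "0 < \<beta>" "0 \<le> c"
  shows "locally_bounded (fan \<beta> c)"
  unfolding locally_bounded_def
proof (intro conjI allI)
  show "fan \<beta> c \<in> borel_measurable borel"
    unfolding fan_def[abs_def] sgn_if by measurable
  fix \<rho> :: real
  show "\<exists>B\<ge>0. \<forall>s. \<bar>s\<bar> \<le> \<rho> \<longrightarrow> \<bar>fan \<beta> c s\<bar> \<le> B"
    using assms by (intro exI[of _ "\<rho> powr \<beta> / \<beta> + c"]) (auto intro: abs_fan_le)
qed

text \<open>Mean value theorem: the derivative \<open>x powr (\<beta> - 1)\<close> is decreasing
  because \<open>\<beta> < 1\<close>, so its values lie between those at \<open>q\<close> and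
  \<open>p\<close>.\<close>

lemma powr_slope:
  fixes \<beta> p s t q :: real
  assumes \<beta>: "0 < \<beta>" "\<beta> < 1" and "0 < p" "p \<le> s" "s \<le> t" "t \<le> q"
  shows "q powr (\<beta> - 1) * (t - s) \<le> t powr \<beta> / \<beta> - s powr \<beta> / \<beta>"
    and "t powr \<beta> / \<beta> - s powr \<beta> / \<beta> \<le> p powr (\<beta> - 1) * (t - s)"
proof -
  have "q powr (\<beta> - 1) * (t - s) \<le> t powr \<beta> / \<beta> - s powr \<beta> / \<beta> \<and>
        t powr \<beta> / \<beta> - s powr \<beta> / \<beta> \<le> p powr (\<beta> - 1) * (t - s)"
  proof (cases "s = t")
    case False
    then have "s < t" using assms by simp
    have "((\<lambda>x. x powr \<beta> / \<beta>) has_real_derivative x powr (\<beta> - 1)) (at x)" if "s \<le> x" for x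
      using that assms by (auto intro!: derivative_eq_intros)
    from MVT2[OF \<open>s < t\<close> this] obtain z where z: "s < z" "z < t"
      "t powr \<beta> / \<beta> - s powr \<beta> / \<beta> = (t - s) * z powr (\<beta> - 1)" by blast
    have "q powr (\<beta> - 1) \<le> z powr (\<beta> - 1)" "z powr (\<beta> - 1) \<le> p powr (\<beta> - 1)"
      using z assms by (auto intro!: powr_mono2')
    then show ?thesis using \<open>s < t\<close> by (simp add: z(3) mult.commute)
  qed simp
  then show "q powr (\<beta> - 1) * (t - s) \<le> t powr \<beta> / \<beta> - s powr \<beta> / \<beta>"
    and "t powr \<beta> / \<beta> - s powr \<beta> / \<beta> \<le> p powr (\<beta> - 1) * (t - s)" by auto
qed

text \<open>The bound survives across 0 because an upward jump only steepens chords. On one side of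
  0 it is the mean value estimate; across 0 the chord is split at the origin.\<close>

lemma fan_slope_ge:
  assumes \<beta>: "0 < \<beta>" "\<beta> < 1" and "0 \<le> c" "s \<le> t" "\<bar>s\<bar> \<le> q" "\<bar>t\<bar> \<le> q"
  shows "q powr (\<beta> - 1) * (t - s) \<le> fan \<beta> c t - fan \<beta> c s"
proof -
  \<comment> \<open>Chords from the origin, where the derivative is singular, are treated by hand
    via \<open>x powr \<beta> = x * x powr (\<beta> - 1)\<close> and
    \<open>\<beta> < 1\<close>.\<close>
  have half: "q powr (\<beta> - 1) * x \<le> x powr \<beta> / \<beta>" if "0 \<le> x" "x \<le> q" for x
  proof (cases "x = 0")
    case False
    then have "q powr (\<beta> - 1) * x \<le> x powr (\<beta> - 1) * x"
      using that \<beta> by (intro mult_right_mono powr_mono2') auto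
    also have "\<dots> = x powr \<beta>" using False that by (simp add: powr_mult_base mult.commute)
    also have "\<dots> \<le> x powr \<beta> / \<beta>" using \<beta> by (simp add: pos_le_divide_eq mult_left_le)
    finally show ?thesis .
  qed simp
  have pos: "q powr (\<beta> - 1) * (t - s) \<le> fan \<beta> c t - fan \<beta> c s"
    if "0 < s" "s \<le> t" "t \<le> q" for s t
    using powr_slope(1)[OF \<beta> that(1) order.refl that(2,3)] that by (simp add: fan_def)
  consider "0 < s" | "t < 0" | "s \<le> 0" "0 \<le> t" by linarith
  then show ?thesis
  proof cases
    case 1
    then show ?thesis using pos assms by auto
  next
    case 2
    then show ?thesis using pos[of "- t" "- s"] assms by (simp add: fan_minus)
  next
    case 3
    have "q powr (\<beta> - 1) * x \<le> fan \<beta> c x" if "0 \<le> x" "x \<le> q" for x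
      using half[OF that] that \<open>0 \<le> c\<close> by (cases "x = 0") (auto simp: fan_def)
    from this[of t] this[of "- s"] 3 assms show ?thesis
      by (simp add: fan_minus algebra_simps)
  qed
qed

text \<open>An upper bound must keep the interval at distance \<open>p\<close> from the jump; the
  negative side follows by reflection.\<close>

lemma fan_slope_le:
  assumes \<beta>: "0 < \<beta>" "\<beta> < 1" and "0 < p" "s \<le> t" "p \<le> s \<or> t \<le> - p"
  shows "fan \<beta> c t - fan \<beta> c s \<le> p powr (\<beta> - 1) * (t - s)"
proof (cases "p \<le> s")
  case True
  then show ?thesis
    using powr_slope(2)[OF \<beta> \<open>0 < p\<close>, of s t t] assms by (simp add: fan_def)
next
  case False
  then show ?thesis
    using powr_slope(2)[OF \<beta> \<open>0 < p\<close>, of "- t" "- s" "- s"] assms by (simp add: fan_def)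
qed

lemma fan_mono:
  assumes "0 < \<beta>" "\<beta> < 1" "0 \<le> c" "s \<le> t"
  shows "fan \<beta> c s \<le> fan \<beta> c t"
proof -
  have "0 \<le> max \<bar>s\<bar> \<bar>t\<bar> powr (\<beta> - 1) * (t - s)" using assms by simp
  also have "\<dots> \<le> fan \<beta> c t - fan \<beta> c s" using assms by (intro fan_slope_ge) auto
  finally show ?thesis by simp
qed

lemma isCont_fan:
  assumes "x \<noteq> 0" "0 < \<beta>"
  shows "isCont (fan \<beta> c) x"
  using assms unfolding fan_def[abs_def] by (intro continuous_intros) auto

section \<open>Estimates for the mollified fan\<close>

lemma W_antimono:
  assumes "\<gamma> > 1" "0 < p" "p \<le> q"
  shows "W \<gamma> q \<le> W \<gamma> p"
  unfolding W_def using assms by (intro mult_left_mono powr_mono2') auto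

lemma W_nonneg: "\<gamma> > 1 \<Longrightarrow> 0 \<le> W \<gamma> u"
  by (simp add: W_def)

text \<open>The distance \<open>2 / real n\<close> is the kernel radius \<open>1 / real n\<close>
  plus an equal slack \<open>\<delta>\<close> for the difference quotient. The lower bound on
  \<open>u_moll\<close> holds across the vacuum, the upper one only when the enlarged window misses
  0. The bounds on \<open>r_moll\<close> come from monotonicity of the fan.\<close>

lemma
  assumes \<phi>: "mollifier \<phi>" and \<beta>: "0 < \<beta>" "\<beta> < 1" and c: "0 \<le> c" and n: "0 < n"
  shows u_moll_fan_ge: "(\<bar>\<xi>\<bar> + 2 / real n) powr (\<beta> - 1) \<le> u_moll \<phi> (fan \<beta> c) n \<xi>"
    and u_moll_fan_le: "2 / real n < \<bar>\<xi>\<bar> \<Longrightarrow>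
      u_moll \<phi> (fan \<beta> c) n \<xi> \<le> (\<bar>\<xi>\<bar> - 2 / real n) powr (\<beta> - 1)"
    and r_moll_fan_ge: "fan \<beta> c (\<xi> - 1 / real n) \<le> r_moll \<phi> (fan \<beta> c) n \<xi>"
    and r_moll_fan_le: "r_moll \<phi> (fan \<beta> c) n \<xi> \<le> fan \<beta> c (\<xi> + 1 / real n)"
    and u_moll_fan: "u_moll \<phi> (fan \<beta> c) n \<xi> = real n * r_moll (deriv \<phi>) (fan \<beta> c) n \<xi>"
    and r_moll_fan_DERIV: "(r_moll \<phi> (fan \<beta> c) n has_real_derivative u_moll \<phi> (fan \<beta> c) n \<xi>) (at \<xi>)"
proof -
  let ?F = "fan \<beta> c" and ?d = "1 / real n"
  have sm: "smooth \<phi>" "topological_support \<phi> \<subseteq> {-1<..<1}"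
    using \<phi> by (auto simp: mollifier_def)
  have b: "bump ?d (rescale \<phi> n)" by (intro bump_rescale bump_smooth sm n)
  have nn: "0 \<le> rescale \<phi> n x" for x using \<phi> by (simp add: mollifier_def rescale_def)
  have one: "(LBINT s. rescale \<phi> n s) = 1"
    using \<phi> integral_rescale[OF n, of \<phi>] by (simp add: mollifier_def)
  note lb = locally_bounded_fan[OF \<beta>(1) c]
  have D: "(r_moll \<phi> ?F n has_real_derivative real n * r_moll (deriv \<phi>) ?F n \<xi>) (at \<xi>)"
    by (rule r_moll_has_derivative[OF sm n lb])
  then show eq: "u_moll \<phi> ?F n \<xi> = real n * r_moll (deriv \<phi>) ?F n \<xi>"
    unfolding u_moll_def by (rule DERIV_imp_deriv)
  show D': "(r_moll \<phi> ?F n has_real_derivative u_moll \<phi> ?F n \<xi>) (at \<xi>)"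
    using D by (simp only: eq)
  have d: "0 < ?d" using n by simp
  note D'' = D'[unfolded r_moll_def]
  have d2: "2 / real n = 2 * ?d" by simp
  show "(\<bar>\<xi>\<bar> + 2 / real n) powr (\<beta> - 1) \<le> u_moll \<phi> ?F n \<xi>"
  proof (rule convolve_derivative_ge[OF b nn one lb D'' d])
    fix s t assume "\<xi> - ?d < s" "s < t" "t < \<xi> + ?d + ?d"
    then show "(\<bar>\<xi>\<bar> + 2 / real n) powr (\<beta> - 1) * (t - s) \<le> ?F t - ?F s"
      using d unfolding d2 by (intro fan_slope_ge[OF \<beta> c]) linarith+
  qed
  show "u_moll \<phi> ?F n \<xi> \<le> (\<bar>\<xi>\<bar> - 2 / real n) powr (\<beta> - 1)" if "2 / real n < \<bar>\<xi>\<bar>"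
  proof (rule convolve_derivative_le[OF b nn one lb D'' d])
    fix s t assume "\<xi> - ?d < s" "s < t" "t < \<xi> + ?d + ?d"
    then show "?F t - ?F s \<le> (\<bar>\<xi>\<bar> - 2 / real n) powr (\<beta> - 1) * (t - s)"
      using d that unfolding d2 by (intro fan_slope_le[OF \<beta>]) linarith+
  qed
  have "convolve (rescale \<phi> n) (\<lambda>_. ?F (\<xi> - ?d)) \<xi> \<le> convolve (rescale \<phi> n) ?F \<xi>"
    by (rule convolve_mono[OF b nn locally_bounded_const lb])
      (auto intro!: fan_mono[OF \<beta> c])
  then show "?F (\<xi> - ?d) \<le> r_moll \<phi> ?F n \<xi>"
    by (simp add: convolve_const[OF one] r_moll_def)
  have "convolve (rescale \<phi> n) ?F \<xi> \<le> convolve (rescale \<phi> n) (\<lambda>_. ?F (\<xi> + ?d)) \<xi>"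
    by (rule convolve_mono[OF b nn lb locally_bounded_const])
      (auto intro!: fan_mono[OF \<beta> c])
  then show "r_moll \<phi> ?F n \<xi> \<le> ?F (\<xi> + ?d)"
    by (simp add: convolve_const[OF one] r_moll_def)
qed

lemma u_moll_fan_pos:
  assumes "mollifier \<phi>" "0 < \<beta>" "\<beta> < 1" "0 \<le> c" "0 < n"
  shows "0 < u_moll \<phi> (fan \<beta> c) n \<xi>"
proof -
  have "0 < \<bar>\<xi>\<bar> + 2 / real n" using assms(5) by (intro add_nonneg_pos) auto
  then have "0 < (\<bar>\<xi>\<bar> + 2 / real n) powr (\<beta> - 1)" by simp
  also have "\<dots> \<le> u_moll \<phi> (fan \<beta> c) n \<xi>" by (rule u_moll_fan_ge[OF assms])
  finally show ?thesis .
qed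

section \<open>Convergence of the energy of the mollified fan\<close>

text \<open>Since the continued fan has no edge, \<open>a\<close> is an arbitrary positive number;
  the restriction to the actual wave fan enters only in the theorem.\<close>

lemma
  assumes \<phi>: "mollifier \<phi>" and \<gamma>: "\<gamma> > 1" and \<beta>: "0 < \<beta>" "\<beta> < 1" and c: "0 \<le> c" and a: "0 < a"
  shows energy_density_fan_integrable:
      "0 < n \<Longrightarrow> set_integrable lborel {-a..a} (energy_density \<gamma> \<phi> (fan \<beta> c) n)"
    and energy_fan_tendsto:
      "(\<lambda>n. LBINT \<xi>:{-a..a}. energy_density \<gamma> \<phi> (fan \<beta> c) n \<xi>) \<longlonglongrightarrow>
       (LBINT \<xi>:{-a..a}. W \<gamma> (\<bar>\<xi>\<bar> powr (\<beta> - 1)) + 1/2 * (\<bar>\<xi>\<bar> powr \<beta> / \<beta> + c - \<bar>\<xi>\<bar> powr \<beta>)\<^sup>2)"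
proof -
  let ?F = "fan \<beta> c"
  let ?e = "\<lambda>n. energy_density \<gamma> \<phi> ?F n"
  note lb = locally_bounded_fan[OF \<beta>(1) c]
  have sm: "smooth (deriv \<phi>)" "topological_support (deriv \<phi>) \<subseteq> {-1<..<1}"
    using \<phi> support_deriv[of \<phi>] smooth_deriv by (auto simp: mollifier_def)
  note upos = u_moll_fan_pos[OF \<phi> \<beta> c]
  have int: "set_integrable lborel {-a..a} (?e n)" if n: "0 < n" for n
  proof (rule borel_integrable_atLeastAtMost')
    have "continuous_on {-a..a} (r_moll \<phi> ?F n)"
      using r_moll_fan_DERIV[OF \<phi> \<beta> c n]
      by (meson DERIV_isCont continuous_at_imp_continuous_on)
    \<comment> \<open>As \<open>n\<close> times a mollification by the smooth kernel
      \<open>deriv \<phi>\<close>, \<open>u_moll\<close> is itself differentiable, hence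
      continuous.\<close>
    moreover have u: "u_moll \<phi> ?F n = (\<lambda>\<xi>. real n * r_moll (deriv \<phi>) ?F n \<xi>)"
      by (rule ext) (rule u_moll_fan[OF \<phi> \<beta> c n])
    have "continuous_on {-a..a} (r_moll (deriv \<phi>) ?F n)"
      using r_moll_has_derivative[OF sm n lb]
      by (meson DERIV_isCont continuous_at_imp_continuous_on)
    then have "continuous_on {-a..a} (u_moll \<phi> ?F n)"
      unfolding u by (intro continuous_intros)
    ultimately show "continuous_on {-a..a} (?e n)"
      using upos[OF n] less_imp_neq[OF upos[OF n]]
      unfolding energy_density_def v_moll_def W_def u_moll_def[symmetric]
      by (intro continuous_intros) auto
  qed
  then show "0 < n \<Longrightarrow> set_integrable lborel {-a..a} (?e n)" .
  \<comment> \<open>The margin 1 in \<open>a + 1\<close> absorbs the kernel radius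
    \<open>1 / real n\<close>.\<close>
  define B where "B = (a + 1) powr \<beta> / \<beta> + c"
  have B: "0 \<le> B" "\<And>s. \<bar>s\<bar> \<le> a + 1 \<Longrightarrow> \<bar>?F s\<bar> \<le> B"
    unfolding B_def using \<beta> c by (auto intro: abs_fan_le)
  have bd: "bump 1 (deriv \<phi>)" by (rule bump_smooth[OF sm])
  obtain K where K: "0 \<le> K" "\<And>x. \<bar>deriv \<phi> x\<bar> \<le> K" using bump_bounded[OF bd] by blast
  \<comment> \<open>The summands are the bounds for the two cases of \<open>vbound\<close>, near the
    vacuum and away from it.\<close>
  define V where "V = 8 * K * B + 2 * a powr \<beta>"
  have V: "0 \<le> V" using K(1) B(1) by (simp add: V_def)
  have vbound: "\<bar>\<xi> * u_moll \<phi> ?F n \<xi>\<bar> \<le> V" if n: "0 < n" and \<xi>: "\<bar>\<xi>\<bar> \<le> a" for n \<xi>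
  \<comment> \<open>Beyond \<open>4 / real n\<close>, subtracting \<open>2 / real n\<close> leaves
    at least half of \<open>\<bar>\<xi>\<bar>\<close>.\<close>
  proof (cases "\<bar>\<xi>\<bar> \<le> 4 / real n")
    case True
    \<comment> \<open>Kernel height \<open>real n * K\<close> times window length
      \<open>2 / real n\<close> is independent of \<open>n\<close>. The further factor
      \<open>n\<close> in \<open>u_moll\<close> is cancelled by
      \<open>\<bar>\<xi>\<bar> \<le> 4 / real n\<close>.\<close>
    have "\<bar>r_moll (deriv \<phi>) ?F n \<xi>\<bar> \<le> (real n * K) * B * (2 * (1 / real n))"
      unfolding r_moll_def
    proof (rule convolve_abs_le[OF bump_rescale[OF bd n] lb])
      show "\<bar>rescale (deriv \<phi>) n x\<bar> \<le> real n * K" for x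
        using K(2) by (auto simp: rescale_def abs_mult intro: mult_left_mono)
      fix s assume "\<bar>\<xi> - s\<bar> < 1 / real n"
      moreover have "1 / real n \<le> 1" using n by simp
      ultimately show "\<bar>?F s\<bar> \<le> B" using \<xi> by (intro B) linarith
    qed (use B in auto)
    also have "\<dots> = 2 * K * B" using n by simp
    finally have "\<bar>\<xi> * u_moll \<phi> ?F n \<xi>\<bar> \<le> 4 / real n * (real n * (2 * K * B))"
      unfolding u_moll_fan[OF \<phi> \<beta> c n] abs_mult
      using True by (intro mult_mono) auto
    also have "\<dots> = 8 * K * B" using n by simp
    finally show ?thesis unfolding V_def by (simp add: add_increasing2)
  next
    case False
    then have h: "2 / real n < \<bar>\<xi>\<bar>" "0 < \<bar>\<xi>\<bar> / 2" "\<bar>\<xi>\<bar> / 2 \<le> \<bar>\<xi>\<bar> - 2 / real n"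
      using n by (auto simp: field_simps)
    have "\<bar>\<xi> * u_moll \<phi> ?F n \<xi>\<bar> = \<bar>\<xi>\<bar> * u_moll \<phi> ?F n \<xi>"
      using upos[OF n, of \<xi>] by (simp add: abs_mult)
    also have "\<dots> \<le> \<bar>\<xi>\<bar> * (\<bar>\<xi>\<bar> - 2 / real n) powr (\<beta> - 1)"
      by (intro mult_left_mono u_moll_fan_le[OF \<phi> \<beta> c n h(1)]) auto
    also have "\<dots> \<le> \<bar>\<xi>\<bar> * (\<bar>\<xi>\<bar> / 2) powr (\<beta> - 1)"
      using h \<beta> by (intro mult_left_mono powr_mono2') auto
    also have "\<dots> = 2 * (\<bar>\<xi>\<bar> / 2 * (\<bar>\<xi>\<bar> / 2) powr (\<beta> - 1))" by simp
    \<comment> \<open>The weight \<open>\<xi>\<close> raises the singular exponent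
      \<open>\<beta> - 1\<close> to the positive exponent \<open>\<beta>\<close>.\<close>
    also have "\<dots> = 2 * (\<bar>\<xi>\<bar> / 2) powr \<beta>" using h(2) by (subst powr_mult_base) auto
    also have "\<dots> \<le> 2 * a powr \<beta>" using \<beta> \<xi> by (intro mult_left_mono powr_mono2) auto
    finally show ?thesis unfolding V_def using K(1) B(1) by (simp add: add_increasing)
  qed
  \<comment> \<open>The lower bound on \<open>u_moll\<close> is smallest at
    \<open>\<bar>\<xi>\<bar> = a\<close> and \<open>n = 1\<close>, which gives \<open>a + 2\<close>;
    \<open>W\<close> is decreasing.\<close>
  define C where "C = W \<gamma> ((a + 2) powr (\<beta> - 1)) + 1/2 * (B + V)\<^sup>2"
  have ebound: "\<bar>?e n \<xi>\<bar> \<le> C" if n: "0 < n" and \<xi>: "\<bar>\<xi>\<bar> \<le> a" for n \<xi>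
  proof -
    have n1: "1 / real n \<le> 1" "2 / real n \<le> 2" using n by (auto simp: field_simps)
    have "(a + 2) powr (\<beta> - 1) \<le> (\<bar>\<xi>\<bar> + 2 / real n) powr (\<beta> - 1)"
      using n n1 \<xi> \<beta> by (intro powr_mono2') (auto simp: add_nonneg_pos)
    also have "\<dots> \<le> u_moll \<phi> ?F n \<xi>" by (rule u_moll_fan_ge[OF \<phi> \<beta> c n])
    finally have 1: "W \<gamma> (u_moll \<phi> ?F n \<xi>) \<le> W \<gamma> ((a + 2) powr (\<beta> - 1))"
      using a by (intro W_antimono \<gamma>) auto
    have "0 \<le> 1 / real n" by simp
    with n1 \<xi> have "\<bar>\<xi> - 1 / real n\<bar> \<le> a + 1" "\<bar>\<xi> + 1 / real n\<bar> \<le> a + 1" by linarith+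
    then have "\<bar>r_moll \<phi> ?F n \<xi>\<bar> \<le> B"
      using r_moll_fan_ge[OF \<phi> \<beta> c n, of \<xi>] r_moll_fan_le[OF \<phi> \<beta> c n, of \<xi>]
        B(2)[of "\<xi> - 1 / real n"] B(2)[of "\<xi> + 1 / real n"] by linarith
    with vbound[OF n \<xi>] have "\<bar>v_moll \<phi> ?F n \<xi>\<bar> \<le> B + V"
      unfolding v_moll_def u_moll_def[symmetric] by linarith
    then have "(v_moll \<phi> ?F n \<xi>)\<^sup>2 \<le> (B + V)\<^sup>2" by (simp add: abs_le_square_iff[symmetric] B(1) V)
    with 1 W_nonneg[OF \<gamma>, of "u_moll \<phi> ?F n \<xi>"] show ?thesis
      unfolding energy_density_def C_def by simp
  qed
  let ?l = "\<lambda>\<xi>. W \<gamma> (\<bar>\<xi>\<bar> powr (\<beta> - 1)) + 1/2 * (\<bar>\<xi>\<bar> powr \<beta> / \<beta> + c - \<bar>\<xi>\<bar> powr \<beta>)\<^sup>2"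
  have lim: "(\<lambda>n. ?e n \<xi>) \<longlonglongrightarrow> ?l \<xi>" if "\<xi> \<noteq> 0" for \<xi>
  proof -
    have l0: "(\<lambda>n. k / real n) \<longlonglongrightarrow> 0" for k
      using tendsto_mult_right_zero[OF lim_1_over_n, of k] by simp
    have pos: "\<forall>\<^sub>F n in sequentially. 0 < n" by (rule eventually_gt_at_top)
    have "\<forall>\<^sub>F n in sequentially. 2 / real n < \<bar>\<xi>\<bar>"
      using l0[of 2] that by (intro order_tendstoD) auto
    with pos have ev: "\<forall>\<^sub>F n in sequentially. 0 < n \<and> 2 / real n < \<bar>\<xi>\<bar>" by (rule eventually_conj)
    have u: "(\<lambda>n. u_moll \<phi> ?F n \<xi>) \<longlonglongrightarrow> \<bar>\<xi>\<bar> powr (\<beta> - 1)"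
    proof (rule tendsto_sandwich)
      show "\<forall>\<^sub>F n in sequentially. (\<bar>\<xi>\<bar> + 2 / real n) powr (\<beta> - 1) \<le> u_moll \<phi> ?F n \<xi>"
        using ev by eventually_elim (use u_moll_fan_ge[OF \<phi> \<beta> c] in blast)
      show "\<forall>\<^sub>F n in sequentially. u_moll \<phi> ?F n \<xi> \<le> (\<bar>\<xi>\<bar> - 2 / real n) powr (\<beta> - 1)"
        using ev by eventually_elim (use u_moll_fan_le[OF \<phi> \<beta> c] in blast)
      show "(\<lambda>n. (\<bar>\<xi>\<bar> + 2 / real n) powr (\<beta> - 1)) \<longlonglongrightarrow> \<bar>\<xi>\<bar> powr (\<beta> - 1)"
        using tendsto_powr[OF tendsto_add[OF tendsto_const l0[of 2]] tendsto_const, of "\<bar>\<xi>\<bar>" "\<beta> - 1"]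
          that by simp
      show "(\<lambda>n. (\<bar>\<xi>\<bar> - 2 / real n) powr (\<beta> - 1)) \<longlonglongrightarrow> \<bar>\<xi>\<bar> powr (\<beta> - 1)"
        using tendsto_powr[OF tendsto_diff[OF tendsto_const l0[of 2]] tendsto_const, of "\<bar>\<xi>\<bar>" "\<beta> - 1"]
          that by simp
    qed
    have r: "(\<lambda>n. r_moll \<phi> ?F n \<xi>) \<longlonglongrightarrow> ?F \<xi>"
    proof (rule tendsto_sandwich)
      show "\<forall>\<^sub>F n in sequentially. ?F (\<xi> - 1 / real n) \<le> r_moll \<phi> ?F n \<xi>"
        using pos by eventually_elim (rule r_moll_fan_ge[OF \<phi> \<beta> c])
      show "\<forall>\<^sub>F n in sequentially. r_moll \<phi> ?F n \<xi> \<le> ?F (\<xi> + 1 / real n)"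
        using pos by eventually_elim (rule r_moll_fan_le[OF \<phi> \<beta> c])
      show "(\<lambda>n. ?F (\<xi> - 1 / real n)) \<longlonglongrightarrow> ?F \<xi>"
        using tendsto_diff[OF tendsto_const l0[of 1], of \<xi>]
        by (intro isCont_tendsto_compose[OF isCont_fan[OF that \<beta>(1)]]) simp
      show "(\<lambda>n. ?F (\<xi> + 1 / real n)) \<longlonglongrightarrow> ?F \<xi>"
        using tendsto_add[OF tendsto_const l0[of 1], of \<xi>]
        by (intro isCont_tendsto_compose[OF isCont_fan[OF that \<beta>(1)]]) simp
    qed
    have "\<bar>\<xi>\<bar> * \<bar>\<xi>\<bar> powr (\<beta> - 1) = \<bar>\<xi>\<bar> powr \<beta>" using that by (subst powr_mult_base) auto
    \<comment> \<open>The limit of \<open>v_moll\<close> is odd, and its sign disappears on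
      squaring.\<close>
    then have "?F \<xi> - \<xi> * \<bar>\<xi>\<bar> powr (\<beta> - 1) = sgn \<xi> * (\<bar>\<xi>\<bar> powr \<beta> / \<beta> + c - \<bar>\<xi>\<bar> powr \<beta>)"
      unfolding fan_def by (auto simp: sgn_if)
    then have "(?F \<xi> - \<xi> * \<bar>\<xi>\<bar> powr (\<beta> - 1))\<^sup>2 = (\<bar>\<xi>\<bar> powr \<beta> / \<beta> + c - \<bar>\<xi>\<bar> powr \<beta>)\<^sup>2"
      using that by (simp add: power_mult_distrib sgn_if)
    moreover have "(\<lambda>n. ?e n \<xi>) \<longlonglongrightarrow>
        W \<gamma> (\<bar>\<xi>\<bar> powr (\<beta> - 1)) + 1/2 * (?F \<xi> - \<xi> * \<bar>\<xi>\<bar> powr (\<beta> - 1))\<^sup>2"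
      unfolding energy_density_def v_moll_def W_def u_moll_def[symmetric]
      using that by (intro tendsto_intros r u) auto
    ultimately show ?thesis by simp
  qed
  \<comment> \<open>Dominated convergence needs its hypotheses at every index, whereas the estimates
    require \<open>0 < n\<close>; hence the shift to \<open>Suc n\<close>.\<close>
  have "(\<lambda>n. LBINT \<xi>:{-a..a}. ?e (Suc n) \<xi>) \<longlonglongrightarrow> (LBINT \<xi>:{-a..a}. ?l \<xi>)"
    unfolding set_lebesgue_integral_def
  proof (rule integral_dominated_convergence)
    show "(\<lambda>\<xi>. indicator {-a..a} \<xi> *\<^sub>R ?l \<xi>) \<in> borel_measurable lborel"
      unfolding W_def by measurable
    show "(\<lambda>\<xi>. indicator {-a..a} \<xi> *\<^sub>R ?e (Suc i) \<xi>) \<in> borel_measurable lborel" for i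
      using int[of "Suc i"] by (auto simp: set_integrable_def dest: borel_measurable_integrable)
    show "integrable lborel (\<lambda>\<xi>. C * indicator {-a..a} \<xi> :: real)"
      by (rule integrable_indicator_Icc)
    show "AE \<xi> in lborel. (\<lambda>i. indicator {-a..a} \<xi> *\<^sub>R ?e (Suc i) \<xi>)
        \<longlonglongrightarrow> indicator {-a..a} \<xi> *\<^sub>R ?l \<xi>"
      \<comment> \<open>Pointwise convergence is known only off the vacuum, a null point.\<close>
      using AE_lborel_singleton[of "0::real"]
      by eventually_elim (intro tendsto_scaleR tendsto_const LIMSEQ_Suc lim)
    show "AE \<xi> in lborel. norm (indicator {-a..a} \<xi> *\<^sub>R ?e (Suc i) \<xi>) \<le> C * indicator {-a..a} \<xi>" for i
      using ebound[of "Suc i"] by (intro AE_I2) (auto simp: indicator_def abs_le_iff)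
  qed
  then show "(\<lambda>n. LBINT \<xi>:{-a..a}. ?e n \<xi>) \<longlonglongrightarrow> (LBINT \<xi>:{-a..a}. ?l \<xi>)"
    by (rule LIMSEQ_imp_Suc)
qed

section \<open>Transfer from the continued fan to the given motion\<close>

theorem proposition4p6:
  fixes \<gamma> ubar vbar w xiF xibar :: real
    and \<phi> r :: "real \<Rightarrow> real"
    and y :: "real \<Rightarrow> real \<Rightarrow> real"
  assumes "mollifier \<phi>"
    and "\<gamma> > 1" and "ubar > 0" and "vbar > 0"
    and "w = ubar powr ((1 - \<gamma>) / 2) + (1 - \<gamma>) / 2 * vbar" and "w < 0"
    and "xiF = ubar powr (- (\<gamma> + 1) / 2)"
    and "\<And>\<xi>. 0 < \<xi> \<Longrightarrow> \<xi> \<le> xiF \<Longrightarrow>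
           r \<xi> = (\<gamma> + 1) / (\<gamma> - 1) * \<xi> powr ((\<gamma> - 1) / (\<gamma> + 1)) - 2 / (\<gamma> - 1) * w"
    and "\<And>\<xi>. xiF \<le> \<xi> \<Longrightarrow> r \<xi> = ubar * \<xi> + vbar"
    and "\<And>\<xi>. \<xi> < 0 \<Longrightarrow> r \<xi> = - r (- \<xi>)"
    and "\<And>x t. 0 < t \<Longrightarrow> x \<noteq> 0 \<Longrightarrow> y x t = t * r (x / t)"
    and "0 < xibar" and "xibar < xiF"
  shows "has_fan_energy \<gamma> \<phi> y xibar
           (LBINT \<xi>:{-xibar..xibar}.
              1 / (\<gamma> * (\<gamma> - 1)) * \<bar>\<xi>\<bar> powr (2 * (\<gamma> - 1) / (\<gamma> + 1))
              + 2 / (\<gamma> - 1)\<^sup>2 * (\<bar>\<xi>\<bar> powr ((\<gamma> - 1) / (\<gamma> + 1)) - w)\<^sup>2)"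
proof -
  note \<phi> = assms(1) and \<gamma> = assms(2)
  define \<beta> where "\<beta> = (\<gamma> - 1) / (\<gamma> + 1)"
  define c where "c = - 2 / (\<gamma> - 1) * w"
  have \<beta>: "0 < \<beta>" "\<beta> < 1" using \<gamma> by (auto simp: \<beta>_def)
  \<comment> \<open>The sign of \<open>w\<close> is what makes the jump at the vacuum point
    upwards.\<close>
  have c: "0 \<le> c" using \<gamma> \<open>w < 0\<close> by (simp add: c_def divide_simps)
  let ?F = "fan \<beta> c" and ?R = "profile y"
  have b: "bump 1 \<phi>" using \<phi> by (intro bump_smooth) (auto simp: mollifier_def)
  have F: "?F \<in> borel_measurable borel"
    using locally_bounded_fan[OF \<beta>(1) c] by (simp add: locally_bounded_def)
  have pos: "?R s = ?F s" if "0 < s" "s \<le> xiF" for s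
    using assms(8)[OF that] assms(11)[of 1 s] that \<gamma>
    by (simp add: profile_def fan_def \<beta>_def c_def)
  have R: "?R s = ?F s" if "s \<noteq> 0" "\<bar>s\<bar> \<le> xiF" for s
  proof (cases "0 < s")
    case False
    then have "?R s = - ?R (- s)"
      using assms(10)[of s] assms(11)[of 1 s] assms(11)[of 1 "- s"] that
      by (simp add: profile_def)
    then show ?thesis using pos[of "- s"] False that by (simp add: fan_minus)
  qed (use pos that in auto)
  \<comment> \<open>The window of radius \<open>1 / real n\<close> about such a point stays inside
    the fan edge, where profile and fan agree off 0.\<close>
  have eq: "r_moll \<phi> ?R n \<xi> = r_moll \<phi> ?F n \<xi>"
    if "0 < n" "\<bar>\<xi>\<bar> < xiF - 1 / real n" for n \<xi>
    by (rule r_moll_cong[OF b that(1) F], rule R) (use that in linarith)+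
  \<comment> \<open>Derivatives need agreement on a neighbourhood, which the strict inequality
    provides.\<close>
  have DR: "(r_moll \<phi> ?R n has_real_derivative u_moll \<phi> ?F n \<xi>) (at \<xi>)"
    if n: "0 < n" and \<xi>: "\<bar>\<xi>\<bar> < xiF - 1 / real n" for n \<xi>
  proof (rule has_field_derivative_transform_within_open[OF r_moll_fan_DERIV[OF \<phi> \<beta> c n]])
    show "open {- (xiF - 1 / real n)<..<xiF - 1 / real n}" by simp
    show "\<xi> \<in> {- (xiF - 1 / real n)<..<xiF - 1 / real n}" using \<xi> by auto
    show "r_moll \<phi> ?F n x = r_moll \<phi> ?R n x"
      if "x \<in> {- (xiF - 1 / real n)<..<xiF - 1 / real n}" for x
      using eq[OF n, of x] that by (auto simp: abs_less_iff)
  qed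
  have u: "u_moll \<phi> ?R n \<xi> = u_moll \<phi> ?F n \<xi>"
    if "0 < n" "\<bar>\<xi>\<bar> < xiF - 1 / real n" for n \<xi>
    using DERIV_imp_deriv[OF DR[OF that]] by (simp add: u_moll_def)
  have e: "energy_density \<gamma> \<phi> ?R n \<xi> = energy_density \<gamma> \<phi> ?F n \<xi>"
    if "0 < n" "\<bar>\<xi>\<bar> < xiF - 1 / real n" for n \<xi>
    unfolding energy_density_def v_moll_def u_moll_def[symmetric] using u[OF that] eq[OF that] by simp
  have "(\<lambda>n. 1 / real n) \<longlonglongrightarrow> 0" by (rule lim_1_over_n)
  then have "\<forall>\<^sub>F n in sequentially. 1 / real n < xiF - xibar"
    using \<open>xibar < xiF\<close> by (intro order_tendstoD) auto
  with eventually_gt_at_top[of 0]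
  \<comment> \<open>The gap between \<open>xibar\<close> and \<open>xiF\<close> eventually exceeds
    the kernel radius, uniformly in \<open>\<xi>\<close>.\<close>
  have ev: "\<forall>\<^sub>F n in sequentially. 0 < n \<and> (\<forall>\<xi>\<in>{-xibar..xibar}. \<bar>\<xi>\<bar> < xiF - 1 / real n)"
    by eventually_elim (auto simp: abs_less_iff)
  have limit: "W \<gamma> (\<bar>\<xi>\<bar> powr (\<beta> - 1)) + 1/2 * (\<bar>\<xi>\<bar> powr \<beta> / \<beta> + c - \<bar>\<xi>\<bar> powr \<beta>)\<^sup>2
     = 1 / (\<gamma> * (\<gamma> - 1)) * \<bar>\<xi>\<bar> powr (2 * (\<gamma> - 1) / (\<gamma> + 1))
       + 2 / (\<gamma> - 1)\<^sup>2 * (\<bar>\<xi>\<bar> powr ((\<gamma> - 1) / (\<gamma> + 1)) - w)\<^sup>2" for \<xi>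
  proof -
    have 1: "(\<beta> - 1) * (1 - \<gamma>) = 2 * (\<gamma> - 1) / (\<gamma> + 1)"
      using \<gamma> by (simp add: \<beta>_def field_simps)
    \<comment> \<open>This rests on \<open>1 / \<beta> - 1 = 2 / (\<gamma> - 1)\<close>, which is
      also the factor of \<open>- w\<close> in \<open>c\<close>.\<close>
    have "x / \<beta> + c - x = 2 / (\<gamma> - 1) * (x - w)" for x
      using \<gamma> by (simp add: \<beta>_def c_def divide_simps) (simp add: algebra_simps)
    then have "1/2 * (x / \<beta> + c - x)\<^sup>2 = 2 / (\<gamma> - 1)\<^sup>2 * (x - w)\<^sup>2" for x
      by (simp only: power_mult_distrib power_divide) simp
    then show ?thesis by (simp add: W_def powr_powr 1 flip: \<beta>_def)
  qed
  note energy = energy_fan_tendsto[OF \<phi> \<gamma> \<beta> c \<open>0 < xibar\<close>, unfolded limit]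
  show ?thesis
    unfolding has_fan_energy_def
  proof (intro conjI)
    show "\<forall>\<^sub>F n in sequentially. \<forall>\<xi>\<in>{-xibar..xibar}.
        r_moll \<phi> ?R n differentiable (at \<xi>) \<and> 0 < u_moll \<phi> ?R n \<xi>"
      using ev
    proof eventually_elim
      case (elim n)
      show ?case
      proof
        fix \<xi> assume "\<xi> \<in> {-xibar..xibar}"
        then have \<xi>: "0 < n" "\<bar>\<xi>\<bar> < xiF - 1 / real n" using elim by auto
        show "r_moll \<phi> ?R n differentiable (at \<xi>) \<and> 0 < u_moll \<phi> ?R n \<xi>"
          using DR[OF \<xi>] u_moll_fan_pos[OF \<phi> \<beta> c \<xi>(1)]
          by (auto simp: u[OF \<xi>] real_differentiable_def)
      qed
    qed
    show "\<forall>\<^sub>F n in sequentially.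
        set_integrable lborel {-xibar..xibar} (energy_density \<gamma> \<phi> ?R n)"
      using ev
    proof eventually_elim
      case (elim n)
      then have "set_integrable lborel {-xibar..xibar} (energy_density \<gamma> \<phi> ?R n)
          = set_integrable lborel {-xibar..xibar} (energy_density \<gamma> \<phi> ?F n)"
        by (intro set_integrable_cong) (auto simp: e)
      then show ?case
        using energy_density_fan_integrable[OF \<phi> \<gamma> \<beta> c \<open>0 < xibar\<close>] elim by blast
    qed
    have "\<forall>\<^sub>F n in sequentially. (LBINT \<xi>:{-xibar..xibar}. energy_density \<gamma> \<phi> ?F n \<xi>)
        = (LBINT \<xi>:{-xibar..xibar}. energy_density \<gamma> \<phi> ?R n \<xi>)"
      using ev
    proof eventually_elim
      case (elim n)
      then have "energy_density \<gamma> \<phi> ?F n \<xi> = energy_density \<gamma> \<phi> ?R n \<xi>"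
        if "\<xi> \<in> {-xibar..xibar}" for \<xi>
        using e[of n \<xi>] that by auto
      then show ?case by (intro set_lebesgue_integral_cong) auto
    qed
    then show "(\<lambda>n. LBINT \<xi>:{-xibar..xibar}. energy_density \<gamma> \<phi> ?R n \<xi>) \<longlonglongrightarrow>
        (LBINT \<xi>:{-xibar..xibar}.
              1 / (\<gamma> * (\<gamma> - 1)) * \<bar>\<xi>\<bar> powr (2 * (\<gamma> - 1) / (\<gamma> + 1))
              + 2 / (\<gamma> - 1)\<^sup>2 * (\<bar>\<xi>\<bar> powr ((\<gamma> - 1) / (\<gamma> + 1)) - w)\<^sup>2)"
      by (rule Lim_transform_eventually[OF energy])
  qed
qed

end
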